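(* For every $n>1$, the game Cycles with Sources played on the graph consisting of a single simple cycle with $n$ edges, all edges being initially unmarked, has Nimber $0$.
   Context: The graph is the cycle with $n$ vertices and $n$ edges (for $n=2$, two vertices joined by two parallel edges). Cycles with Sources is the following two-player impartial game on a graph. Initially all edges are unmarked. The players alternate; a move consists of choosing an unmarked edge and marking it with an arrow in one of its two directions, subject to the rule that no move may create a sink. A sink is a vertex all of whose incident edges are marked and directed toward it. Creating sources (vertices all of whose incident edges are marked and directed away from them) is allowed. A player wins by completing a cycle cell (a cell of the graph all of whose boundary edges are marked in one consistent cyclic direction) or by making the last legal move. On a graph consisting of a single cycle, completing a cycle cell requires all edges to be marked, so the game is simply: the player who makes the last legal move wins. The Nimber (Sprague–Grundy value) of a position is the mex (minimum excluded non-negative integer) of the Nimbers of all positions reachable in one move. *)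

theory Defs imports Main
begin

definition mex :: "nat set \<Rightarrow> nat" where
  "mex A = (LEAST k. k \<notin> A)"

text \<open>An impartial game is given by the function mapping a position to the set of positions
  reachable from it in one move. The recursion below is meaningful when this relation is
  well-founded, see \<open>nimber_unfold\<close> and \<open>wf_game_moves\<close>.\<close>

definition nimber :: "('p \<Rightarrow> 'p set) \<Rightarrow> 'p \<Rightarrow> nat" where
  "nimber opts = wfrec {(q, p). q \<in> opts p} (\<lambda>f p. mex (f ` opts p))"

lemma nimber_unfold:
  assumes "wf {(q, p). q \<in> opts p}"
  shows "nimber opts p = mex (nimber opts ` opts p)"
proof -
  let ?R = "{(q, p). q \<in> opts p}"
  have "nimber opts p = mex (cut (nimber opts) ?R p ` opts p)"
    unfolding nimber_def by (rule wfrec[OF assms])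
  also have "cut (nimber opts) ?R p ` opts p = nimber opts ` opts p"
    by (rule image_cong) (auto simp: cut_def)
  finally show ?thesis .
qed

text \<open>Boards are finite loop-free multigraphs with distinguished cells. A cell is given by its
  boundary cycle \<open>[(v\<^sub>0, e\<^sub>0), \<dots>, (v\<^sub>k, e\<^sub>k)]\<close>, where \<open>e\<^sub>i\<close> joins \<open>v\<^sub>i\<close> to its cyclic
  successor.\<close>

record ('v, 'e) board =
  verts :: "'v set"
  edges :: "'e set"
  ends :: "'e \<Rightarrow> 'v set"
  cells :: "('v \<times> 'e) list set"

text \<open>A marked edge is mapped to the endpoint its arrow points to; as there are no loops, this
  determines the direction.\<close>

type_synonym ('v, 'e) position = "'e \<rightharpoonup> 'v"

definition sink :: "('v, 'e) board \<Rightarrow> ('v, 'e) position \<Rightarrow> 'v \<Rightarrow> bool" where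
  "sink G m v \<longleftrightarrow> v \<in> verts G \<and> (\<forall>e \<in> edges G. v \<in> ends G e \<longrightarrow> m e = Some v)"

definition cycle_cell :: "('v, 'e) position \<Rightarrow> ('v \<times> 'e) list \<Rightarrow> bool" where
  "cycle_cell m c \<longleftrightarrow>
     (\<forall>i < length c. m (snd (c ! i)) = Some (fst (c ! (Suc i mod length c)))) \<or>
     (\<forall>i < length c. m (snd (c ! i)) = Some (fst (c ! i)))"

text \<open>The play ends as soon as a cycle cell is completed, so there are no moves from such a
  position.\<close>

definition game_moves ::
    "('v, 'e) board \<Rightarrow> ('v, 'e) position \<Rightarrow> ('v, 'e) position set" where
  "game_moves G m =
     (if \<exists>c \<in> cells G. cycle_cell m c then {}
      else {m(e \<mapsto> v) | e v.
              e \<in> edges G \<and> m e = None \<and> v \<in> ends G e \<and>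
              (\<forall>w. sink G (m(e \<mapsto> v)) w \<longrightarrow> sink G m w)})"

lemma wf_game_moves:
  assumes "finite (edges G)"
  shows "wf {(q, p). q \<in> game_moves G p}"
proof (rule wf_subset[OF wf_measure])
  show "{(q, p). q \<in> game_moves G p} \<subseteq> measure (\<lambda>p. card {e \<in> edges G. p e = None})"
  proof clarify
    fix q p assume "q \<in> game_moves G p"
    then obtain e v where e: "e \<in> edges G" "p e = None" and q: "q = p(e \<mapsto> v)"
      by (auto simp: game_moves_def split: if_splits)
    have "{e \<in> edges G. q e = None} \<subset> {e \<in> edges G. p e = None}"
      using e by (auto simp: q split: if_splits)
    then show "(q, p) \<in> measure (\<lambda>p. card {e \<in> edges G. p e = None})"
      using assms by (auto intro!: psubset_card_mono)
  qed
qed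

text \<open>Edge \<open>i\<close> joins vertices \<open>i\<close> and \<open>i + 1\<close> modulo \<open>n\<close>; for \<open>n = 2\<close> this gives two parallel
  edges. The only cell is the interior of the cycle.\<close>

definition cycle_board :: "nat \<Rightarrow> (nat, nat) board" where
  "cycle_board n =
     \<lparr>verts = {..<n}, edges = {..<n}, ends = (\<lambda>i. {i, Suc i mod n}),
      cells = {map (\<lambda>i. (i, i)) [0..<n]}\<rparr>"

end

theory Submission imports Defs "HOL-Library.Multiset"
begin

text \<open>Read every arrow as \<open>+\<close> (from \<open>e\<close> to \<open>e + 1\<close>) or \<open>-\<close>; a sink is a \<open>+\<close> immediately followed
  by a \<open>-\<close>. Marked edges cut the cycle into independent gaps, each given by its two bounding signs
  and its length. By reflection the gaps \<open>+0\<^sup>k+\<close> and \<open>-0\<^sup>k-\<close> are equivalent; call them \<open>A k\<close>.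
  Less obviously, \<open>+0\<^bsup>k+1\<^esup>-\<close> and \<open>-0\<^sup>k+\<close> have the same options up to this identification; call
  them \<open>B k\<close>. A move replaces \<open>A k\<close> by \<open>A i + A j\<close> with \<open>i + j + 1 = k\<close> or by \<open>B i + B j\<close> with
  \<open>i + j + 2 = k\<close>, and \<open>B k\<close> by \<open>A i + B j\<close> with \<open>i + j + 1 = k\<close>. A position in which every gap
  class occurs an even number of times is lost for the player to move, who can be copied. The first
  move leaves the single gap \<open>A (n - 1)\<close>, which can be answered by two copies of \<open>A\<close> or of \<open>B\<close>,
  according to the parity of \<open>n\<close>.\<close>

section \<open>Nimber zero and second-player strategies\<close>

lemma mex_eq_0: "0 \<notin> S \<Longrightarrow> mex S = 0"
  by (simp add: mex_def Least_equality)

text \<open>Finiteness supplies a non-member, so that the \<open>LEAST\<close> in \<open>mex\<close>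
  is attained outside \<open>S\<close>.\<close>

lemma mex_neq_0: "0 \<in> S \<Longrightarrow> finite S \<Longrightarrow> mex S \<noteq> 0"
proof -
  assume "0 \<in> S" "finite S"
  then obtain k where "k \<notin> S" using ex_new_if_finite infinite_UNIV_nat by blast
  then have "mex S \<notin> S" unfolding mex_def by (rule LeastI)
  then show ?thesis using \<open>0 \<in> S\<close> by metis
qed

text \<open>\<open>Z\<close> is closed under a move followed by a suitable reply. The induction
  descends two moves at a time, hence along the transitive closure.\<close>

lemma nimber_eq_0I:
  assumes wf: "wf {(q, p). q \<in> opts p}"
    and fin: "\<And>p. finite (opts p)"
    and answer: "\<And>p q. p \<in> Z \<Longrightarrow> q \<in> opts p \<Longrightarrow> \<exists>r \<in> opts q. r \<in> Z"
    and "p \<in> Z"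
  shows "nimber opts p = 0"
  using \<open>p \<in> Z\<close>
proof (induction p rule: wf_induct_rule[OF wf_trancl[OF wf]])
  case (1 p)
  have "nimber opts q \<noteq> 0" if q: "q \<in> opts p" for q
  proof -
    from answer[OF 1(2) q] obtain r where r: "r \<in> opts q" "r \<in> Z" by blast
    then have "(r, p) \<in> {(q, p). q \<in> opts p}\<^sup>+"
      using q by (auto intro: trancl_into_trancl)
    then have "nimber opts r = 0" using 1(1) r by blast
    then have "0 \<in> nimber opts ` opts q" using r by (metis imageI)
    then show ?thesis
      unfolding nimber_unfold[OF wf, of q] by (rule mex_neq_0) (simp add: fin)
  qed
  then show ?case
    unfolding nimber_unfold[OF wf, of p] by (intro mex_eq_0) (metis imageE)
qed

section \<open>Gap classes\<close>

datatype gap_class = A nat | B nat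

inductive split :: "gap_class \<Rightarrow> gap_class multiset \<Rightarrow> bool" where
  AA: "split (A (Suc (i + j))) {#A i, A j#}"
| AB: "split (A (Suc (Suc (i + j)))) {#B i, B j#}"
| BA: "split (B (Suc (i + j))) {#A i, B j#}"

definition step :: "gap_class multiset \<Rightarrow> gap_class multiset \<Rightarrow> bool" where
  "step M M' \<longleftrightarrow> (\<exists>x N P. M = add_mset x N \<and> split x P \<and> M' = N + P)"

lemma stepI: "split x P \<Longrightarrow> step (add_mset x N) (N + P)"
  unfolding step_def by blast

lemma step_add_left: "step M M' \<Longrightarrow> step (K + M) (K + M')"
  unfolding step_def by (metis union_mset_add_mset_right add.assoc)

text \<open>The copying strategy: a move in one copy of \<open>x\<close> leaves its twin untouched,
  and the reply splits the twin in the same way.\<close>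

lemma step_double:
  assumes "step (N + N) M"
  obtains K where "step M (K + K)"
proof -
  from assms obtain x N' P where x: "N + N = add_mset x N'" "split x P" and M: "M = N' + P"
    unfolding step_def by blast
  then have "x \<in># N" by (metis union_iff union_single_eq_member)
  then obtain N0 where N: "N = add_mset x N0" by (metis insert_DiffM)
  with x have "N' = add_mset x (N0 + N0)" by auto
  with M have "M = add_mset x (N0 + N0 + P)" by simp
  with x(2) have "step M ((N0 + N0 + P) + P)" by (simp only: stepI)
  also have "(N0 + N0 + P) + P = (N0 + P) + (N0 + P)" by (simp add: ac_simps)
  finally show thesis by (rule that)
qed

lemma step_A_double:
  assumes "k > 0"
  obtains K where "step {#A k#} (K + K)"
proof (cases "even k")
  case True
  with assms obtain i where "k = Suc (Suc (i + i))"
    by (metis evenE gr0_conv_Suc mult_2 add_Suc_right add_Suc mult_0_right not_gr0)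
  then have "step {#A k#} ({#B i#} + {#B i#})"
    using stepI[OF AB[of i i], of "{#}"] by simp
  then show thesis by (rule that)
next
  case False
  then obtain i where "k = Suc (i + i)" by (metis oddE mult_2 Suc_eq_plus1)
  then have "step {#A k#} ({#A i#} + {#A i#})"
    using stepI[OF AA[of i i], of "{#}"] by simp
  then show thesis by (rule that)
qed

text \<open>The signs are \<open>True\<close> for \<open>+\<close> and \<open>False\<close> for \<open>-\<close>. The value of \<open>gap True 0 False\<close> is junk:
  this gap would be a sink.\<close>

definition gap :: "bool \<Rightarrow> nat \<Rightarrow> bool \<Rightarrow> gap_class" where
  "gap s k t = (if s = t then A k else if s then B (k - 1) else B k)"

definition gap_ok :: "bool \<Rightarrow> nat \<Rightarrow> bool \<Rightarrow> bool" where
  "gap_ok s k t \<longleftrightarrow> \<not> (s \<and> \<not> t \<and> k = 0)"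

text \<open>With its converse \<open>split_gapE\<close>, this shows that the splits of a class are
  exactly the legal markings inside any gap of that class. Hence gaps of equal class may be
  identified.\<close>

lemma split_gap:
  assumes "gap_ok s i u" "gap_ok u j t"
  shows "split (gap s (Suc (i + j)) t) {#gap s i u, gap u j t#}"
proof -
  have BA': "split (B (Suc (i + j))) {#B i, A j#}" for i j
    using BA[of j i] by (simp add: add_mset_commute add.commute)
  show ?thesis
    using assms
    by (cases s; cases u; cases t)
       (auto simp: gap_def gap_ok_def gr0_conv_Suc AA AB BA BA')
qed

lemma split_gapE:
  assumes "split (gap s k t) P" "gap_ok s k t"
  obtains i u j where "k = Suc (i + j)" "gap_ok s i u" "gap_ok u j t"
    "P = {#gap s i u, gap u j t#}"
  using assms(1)
proof cases
  case (AA i j)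
  then have "s = t" "k = Suc (i + j)" by (auto simp: gap_def split: if_splits)
  then show thesis
    using AA by (intro that[of i j s]) (auto simp: gap_def gap_ok_def)
next
  case (AB i j)
  then have *: "s = t" "k = Suc (Suc (i + j))" by (auto simp: gap_def split: if_splits)
  show thesis
  \<comment> \<open>A new sign opposite to \<open>s = t\<close> creates one half
    \<open>+...-\<close> and one half \<open>-...+\<close>. The former is one edge longer than its
    \<open>B\<close> index, which decides where \<open>Suc\<close> goes.\<close>
  proof (cases s)
    case True
    then show thesis using AB * by (intro that[of "Suc i" j False]) (auto simp: gap_def gap_ok_def)
  next
    case False
    then show thesis using AB * by (intro that[of i "Suc j" True]) (auto simp: gap_def gap_ok_def)
  qed
next
  case (BA i j)
  then have "s \<noteq> t" by (auto simp: gap_def split: if_splits)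
  show thesis
  \<comment> \<open>Repeating the left sign \<open>s\<close> makes the left half an
    \<open>A\<close>; the right half keeps the signs of the whole gap.\<close>
  proof (cases s)
    case True
    with BA \<open>s \<noteq> t\<close> have "k = Suc (i + Suc j)" by (auto simp: gap_def)
    with True BA \<open>s \<noteq> t\<close> show thesis
      by (intro that[of i "Suc j" True]) (auto simp: gap_def gap_ok_def)
  next
    case False
    with BA \<open>s \<noteq> t\<close> have "k = Suc (i + j)" by (auto simp: gap_def)
    with False BA \<open>s \<noteq> t\<close> show thesis
      by (intro that[of i j False]) (auto simp: gap_def gap_ok_def)
  qed
qed

section \<open>Words\<close>

text \<open>A word is given by its first sign and, for every later sign, the number of unmarked edges
  in front of it and the sign itself.\<close>

fun word :: "bool \<Rightarrow> (nat \<times> bool) list \<Rightarrow> bool option list" where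
  "word s [] = [Some s]"
| "word s ((k, t) # L) = Some s # replicate k None @ word t L"

fun gaps :: "bool \<Rightarrow> (nat \<times> bool) list \<Rightarrow> gap_class multiset" where
  "gaps s [] = {#}"
| "gaps s ((k, t) # L) = add_mset (gap s k t) (gaps t L)"

fun gaps_ok :: "bool \<Rightarrow> (nat \<times> bool) list \<Rightarrow> bool" where
  "gaps_ok s [] = True"
| "gaps_ok s ((k, t) # L) = (gap_ok s k t \<and> gaps_ok t L)"

text \<open>There is no wrap-around clause: words read off the cycle end with their first edge
  again, so the pair across the seam is also consecutive.\<close>

definition sink_free :: "bool option list \<Rightarrow> bool" where
  "sink_free W \<longleftrightarrow>
     (\<forall>i. Suc i < length W \<longrightarrow> \<not> (W ! i = Some True \<and> W ! Suc i = Some False))"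

lemma sink_free_Cons:
  "sink_free (x # W) \<longleftrightarrow>
     (W = [] \<or> \<not> (x = Some True \<and> hd W = Some False)) \<and> sink_free W"
proof (cases W)
  case (Cons y V)
  have all_nat: "(\<forall>i. Q i) \<longleftrightarrow> Q 0 \<and> (\<forall>i. Q (Suc i))" for Q :: "nat \<Rightarrow> bool"
    by (metis not0_implies_Suc)
  show ?thesis
    unfolding sink_free_def Cons by (subst all_nat) simp
qed (simp add: sink_free_def)

lemma word_neq_Nil [simp]: "word s L \<noteq> []"
  by (cases L) auto

lemma hd_word [simp]: "hd (word s L) = Some s"
  by (cases L) auto

lemma nth_0_word [simp]: "word s L ! 0 = Some s"
  by (cases L) auto

lemma last_word: "last (word s L) \<noteq> None"
  by (induction s L rule: word.induct) auto

lemma sink_free_replicate_None: "sink_free (replicate k None @ W) \<longleftrightarrow> sink_free W"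
  by (induction k) (auto simp: sink_free_Cons)

lemma sink_free_word: "sink_free (word s L) \<longleftrightarrow> gaps_ok s L"
proof (induction s L rule: word.induct)
  case (1 s)
  show ?case by (simp add: sink_free_def)
next
  case (2 s k t L)
  then show ?case
    by (cases k) (auto simp: sink_free_Cons sink_free_replicate_None gap_ok_def)
qed

lemma replicate_update:
  "i < k \<Longrightarrow> (replicate k x)[i := y] = replicate i x @ y # replicate (k - Suc i) x"
  by (rule nth_equalityI) (auto simp: nth_append nth_list_update nth_Cons split: nat.splits)

lemma word_update_first_gap:
  "(word s ((Suc (i + j), t) # L))[Suc i := Some u] = word s ((i, u) # (j, t) # L)"
  by (simp del: replicate_Suc add: list_update_append replicate_update)

lemma word_update_step:
  assumes "j < length (word s L)" "word s L ! j = None"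
    and "sink_free ((word s L)[j := Some u])"
  obtains L' where "(word s L)[j := Some u] = word s L'" "gaps_ok s L'"
    "step (gaps s L) (gaps s L')"
proof -
  \<comment> \<open>Legality stays a premise of the step, so the induction need not carry
    sink-freeness over to the tail.\<close>
  have "\<exists>L'. (word s L)[j := Some u] = word s L' \<and>
      (gaps_ok s L' \<longrightarrow> step (gaps s L) (gaps s L'))"
    using assms(1,2)
  proof (induction s L arbitrary: j rule: word.induct)
    case (1 s)
    then show ?case by simp
  next
    case (2 s k t L)
    then obtain i where j: "j = Suc i" by (cases j) auto
    show ?case
    proof (cases "i < k")
      case True
      then obtain l where k: "k = Suc (i + l)" by (metis less_iff_Suc_add)
      have "step (gaps s ((k, t) # L)) (gaps s ((i, u) # (l, t) # L))"
        if "gaps_ok s ((i, u) # (l, t) # L)"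
        using stepI[OF split_gap[of s i u l t], of "gaps t L"] that by (simp add: k)
      then show ?thesis using word_update_first_gap j k by blast
    next
      case False
      then obtain l where i: "i = k + l" by (metis le_iff_add not_less)
      with 2(2,3) j have "l < length (word t L)" "word t L ! l = None"
        by (auto simp: nth_append)
      from 2(1)[OF this] obtain L' where L': "(word t L)[l := Some u] = word t L'"
        "gaps_ok t L' \<Longrightarrow> step (gaps t L) (gaps t L')" by blast
      have "(word s ((k, t) # L))[j := Some u] = word s ((k, t) # L')"
        using L'(1) by (simp add: j i list_update_append)
      moreover have "step (gaps s ((k, t) # L)) (gaps s ((k, t) # L'))" if "gaps_ok t L'"
        using step_add_left[OF L'(2)[OF that], of "{#gap s k t#}"] by simp
      ultimately show ?thesis by (metis gaps_ok.simps(2))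
    qed
  qed
  then show thesis using that assms(3) by (metis sink_free_word)
qed

lemma step_word_update:
  assumes "step (gaps s L) M" "gaps_ok s L"
  obtains j u L' where "j < length (word s L)" "word s L ! j = None"
    "(word s L)[j := Some u] = word s L'" "gaps_ok s L'" "gaps s L' = M"
proof -
  have "\<exists>j u L'. j < length (word s L) \<and> word s L ! j = None \<and>
    (word s L)[j := Some u] = word s L' \<and> gaps_ok s L' \<and> gaps s L' = M"
    using assms
  proof (induction s L arbitrary: M rule: word.induct)
    case (1 s)
    then show ?case by (simp add: step_def)
  next
    case (2 s k t L)
    from 2(2) obtain x N P where x: "add_mset (gap s k t) (gaps t L) = add_mset x N"
      and P: "split x P" and M: "M = N + P" by (auto simp: step_def)
    show ?case
    \<comment> \<open>The multiset does not tell gaps of equal class apart; if \<open>x\<close> is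
      the class of the first gap, the move can be made there.\<close>
    proof (cases "x = gap s k t")
      case True
      with P 2(3) obtain i u l where *: "k = Suc (i + l)" "gap_ok s i u" "gap_ok u l t"
        "P = {#gap s i u, gap u l t#}" by (auto elim: split_gapE)
      have "word s ((k, t) # L) ! Suc i = None"
        by (simp del: replicate_Suc add: *(1) nth_append)
      moreover have "Suc i < length (word s ((k, t) # L))" by (simp add: *(1))
      moreover have "(word s ((k, t) # L))[Suc i := Some u] = word s ((i, u) # (l, t) # L)"
        unfolding *(1) by (rule word_update_first_gap)
      moreover have "gaps_ok s ((i, u) # (l, t) # L)" using * 2(3) by simp
      moreover have "gaps s ((i, u) # (l, t) # L) = M" using x True * M by simp
      ultimately show ?thesis by blast
    next
      case False
      with x obtain N' where N': "gaps t L = add_mset x N'" "N = add_mset (gap s k t) N'"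
        by (auto simp: add_eq_conv_ex)
      then have "step (gaps t L) (N' + P)" using P unfolding step_def by blast
      from 2(1)[OF this] 2(3) obtain j u L' where *: "j < length (word t L)"
        "word t L ! j = None" "(word t L)[j := Some u] = word t L'" "gaps_ok t L'"
        "gaps t L' = N' + P" by auto
      have "word s ((k, t) # L) ! Suc (k + j) = None" using * by (simp add: nth_append)
      moreover have "Suc (k + j) < length (word s ((k, t) # L))" using * by simp
      moreover have "(word s ((k, t) # L))[Suc (k + j) := Some u] = word s ((k, t) # L')"
        using * by (simp add: list_update_append)
      moreover have "gaps_ok s ((k, t) # L')" using * 2(3) by simp
      moreover have "gaps s ((k, t) # L') = M" using * N' M by simp
      ultimately show ?thesis by blast
    qed
  qed
  then show thesis using that by blast
qed

section \<open>Positions on the cycle\<close>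

definition arrow :: "nat \<Rightarrow> nat \<Rightarrow> bool \<Rightarrow> nat" where
  "arrow n e s = (if s then Suc e mod n else e)"

text \<open>The word is read off along the cycle from edge \<open>c\<close>, which is listed again at the end.\<close>

definition reads :: "nat \<Rightarrow> (nat, nat) position \<Rightarrow> nat \<Rightarrow> bool option list \<Rightarrow> bool" where
  "reads n m c W \<longleftrightarrow> length W = Suc n \<and>
     (\<forall>i \<le> n. m ((c + i) mod n) = map_option (arrow n ((c + i) mod n)) (W ! i))"

section \<open>Offsets and sinks on the cycle\<close>

lemma cycle_offset:
  assumes "v < n" "c < (n::nat)"
  obtains i where "i < n" "v = (c + i) mod n"
proof
  show "(v + n - c) mod n < n" using assms by simp
  have "(c + (v + n - c) mod n) mod n = (c + (v + n - c)) mod n" by (rule mod_add_right_eq)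
  also have "c + (v + n - c) = v + n" using assms by simp
  finally show "v = (c + (v + n - c) mod n) mod n" using assms by simp
qed

text \<open>Offsets \<open>0\<close> and \<open>n\<close> denote the same edge, so one of the two
  must lie strictly inside. Thus marking an inner edge changes just one letter of the word.\<close>

lemma cycle_offset_inj:
  assumes "(c + i) mod n = (c + j) mod n" "i \<le> n" "0 < j" "j < (n::nat)"
  shows "i = j"
proof -
  have dvd: "n dvd b - a" if "(c + a) mod n = (c + b) mod n" "a \<le> b" for a b
    using mod_eq_dvd_iff_nat[of "c + a" "c + b" n] that by simp
  have "n dvd j - i" if "i < j" using dvd[of i j] assms(1) that by simp
  moreover have "n dvd i - j" if "j < i" using dvd[of j i] assms(1) that by simp
  ultimately show ?thesis
    using assms(2-4) by (cases i j rule: linorder_cases) (fastforce dest: dvd_imp_le)+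
qed

lemma arrow_True_iff: "n > 1 \<Longrightarrow> e < n \<Longrightarrow> arrow n e s = Suc e mod n \<longleftrightarrow> s"
  by (auto simp: arrow_def mod_Suc)

lemma arrow_False_iff: "n > 1 \<Longrightarrow> e < n \<Longrightarrow> arrow n e s = e \<longleftrightarrow> \<not> s"
  by (auto simp: arrow_def mod_Suc)

text \<open>The vertex is named by the edge entering it in the \<open>+\<close> direction. It has
  exactly two incident edges, which for \<open>n = 2\<close> are parallel but still
  distinct.\<close>

lemma sink_cycle_board:
  assumes "n > 1" "e < n"
  shows "sink (cycle_board n) m (Suc e mod n) \<longleftrightarrow>
    m e = Some (Suc e mod n) \<and> m (Suc e mod n) = Some (Suc e mod n)"
proof -
  have "Suc e mod n = Suc e' mod n \<longleftrightarrow> e = e'" if "e' < n" for e'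
    using that assms by (auto simp: mod_Suc)
  then have incident: "Suc e mod n \<in> {e', Suc e' mod n} \<longleftrightarrow> e' = e \<or> e' = Suc e mod n"
    if "e' < n" for e'
    using that by blast
  have lt: "Suc e mod n < n" using assms by simp
  have "(\<forall>e' < n. Suc e mod n \<in> {e', Suc e' mod n} \<longrightarrow> m e' = Some v) \<longleftrightarrow>
      (\<forall>e' < n. e' = e \<or> e' = Suc e mod n \<longrightarrow> m e' = Some v)" for v
    by (intro all_cong imp_cong[OF incident] refl)
  also have "(\<forall>e' < n. e' = e \<or> e' = Suc e mod n \<longrightarrow> m e' = Some v) \<longleftrightarrow> m e = Some v \<and> m (Suc e mod n) = Some v" for v
    using lt assms(2) by blast
  finally show ?thesis
    using lt by (simp only: sink_def cycle_board_def board.simps lessThan_iff Ball_def simp_thms)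
qed

text \<open>The \<open>n\<close> consecutive pairs of letters correspond to the \<open>n\<close>
  vertices: pair \<open>i\<close> meets at vertex \<open>(c + Suc i) mod n\<close>.\<close>

lemma sink_free_reads:
  assumes n: "n > 1" "c < n" and r: "reads n m c W"
  shows "sink_free W \<longleftrightarrow> (\<forall>v. \<not> sink (cycle_board n) m v)"
proof -
  have sink: "sink (cycle_board n) m ((c + Suc i) mod n) \<longleftrightarrow>
      W ! i = Some True \<and> W ! Suc i = Some False" if "i < n" for i
  proof -
    define e where "e = (c + i) mod n"
    then have Suc_e: "(c + Suc i) mod n = Suc e mod n" by (simp add: mod_Suc_eq)
    have "e < n" using n by (simp add: e_def)
    have "m e = map_option (arrow n e) (W ! i)" using r that by (simp add: reads_def e_def)
    moreover have "m (Suc e mod n) = map_option (arrow n (Suc e mod n)) (W ! Suc i)"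
      using r that unfolding reads_def Suc_e[symmetric] by (metis Suc_leI)
    moreover have "Suc e mod n < n" using n by simp
    ultimately show ?thesis
      unfolding Suc_e sink_cycle_board[OF n(1) \<open>e < n\<close>]
      using n(1) \<open>e < n\<close> by (auto simp: arrow_True_iff arrow_False_iff)
  qed
  have "\<exists>i<n. v = (c + Suc i) mod n" if "sink (cycle_board n) m v" for v
  proof -
    have "v < n" using that by (simp add: sink_def cycle_board_def)
    moreover have "Suc c mod n < n" using n by simp
    ultimately obtain i where i: "i < n" "v = (Suc c mod n + i) mod n" by (rule cycle_offset)
    have "(Suc c mod n + i) mod n = (c + Suc i) mod n" by (simp add: mod_add_left_eq)
    with i show ?thesis by blast
  qed
  moreover have "sink_free W \<longleftrightarrow> (\<forall>i<n. \<not> sink (cycle_board n) m ((c + Suc i) mod n))"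
    using sink r by (simp add: sink_free_def reads_def)
  ultimately show ?thesis by blast
qed

lemma reads_update:
  assumes "reads n m c W" "0 < j" "j < n" "e = (c + j) mod n"
  shows "reads n (m(e \<mapsto> arrow n e u)) c (W[j := Some u])"
proof -
  have "(c + i) mod n = e \<longleftrightarrow> i = j" if "i \<le> n" for i
    using cycle_offset_inj[of c i n j] that assms by auto
  then show ?thesis using assms unfolding reads_def by (auto simp: nth_list_update)
qed

section \<open>Legal moves on the cycle\<close>

lemma cycle_cell_marked:
  assumes "\<exists>d \<in> cells (cycle_board n). cycle_cell m d" "e < n"
  shows "m e \<noteq> None"
  using assms by (force simp: cycle_board_def cycle_cell_def)

text \<open>The rule forbids only new sinks; starting without sinks, this means that the resulting
  position has none at all.\<close>

lemma game_movesE: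
  assumes "q \<in> game_moves (cycle_board n) m" "\<And>v. \<not> sink (cycle_board n) m v"
  obtains e s where "e < n" "m e = None" "q = m(e \<mapsto> arrow n e s)"
    "\<And>v. \<not> sink (cycle_board n) q v"
proof -
  from assms obtain e v where e: "e < n" "m e = None" "q = m(e \<mapsto> v)" "v \<in> {e, Suc e mod n}"
    "\<And>v. \<not> sink (cycle_board n) q v"
    by (auto simp: game_moves_def cycle_board_def split: if_splits)
  then show thesis
    using that[of e True] that[of e False] by (auto simp: arrow_def)
qed

lemma game_movesI:
  assumes "e < n" "m e = None" "\<And>v. \<not> sink (cycle_board n) (m(e \<mapsto> arrow n e s)) v"
  shows "m(e \<mapsto> arrow n e s) \<in> game_moves (cycle_board n) m"
proof -
  \<comment> \<open>A completed cell has every edge marked, so it never ends the play while an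
    unmarked edge such as \<open>e\<close> remains.\<close>
  have "\<not> (\<exists>d \<in> cells (cycle_board n). cycle_cell m d)"
    using cycle_cell_marked assms by blast
  moreover have "e \<in> edges (cycle_board n)" "arrow n e s \<in> ends (cycle_board n) e"
    using assms by (auto simp: cycle_board_def arrow_def)
  ultimately show ?thesis
    unfolding game_moves_def using assms by auto
qed

lemma finite_game_moves_cycle: "finite (game_moves (cycle_board n) m)"
proof (rule finite_subset)
  show "game_moves (cycle_board n) m \<subseteq> (\<lambda>(e, v). m(e \<mapsto> v)) ` ({..<n} \<times> {..n})"
  proof
    fix q assume "q \<in> game_moves (cycle_board n) m"
    then obtain e v where "q = m(e \<mapsto> v)" "e < n" "v \<in> {e, Suc e mod n}"
      by (auto simp: game_moves_def cycle_board_def split: if_splits)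
    moreover from this have "v \<le> n" using mod_less_eq_dividend[of "Suc e" n] by auto
    ultimately show "q \<in> (\<lambda>(e, v). m(e \<mapsto> v)) ` ({..<n} \<times> {..n})"
      by (intro image_eqI[of _ _ "(e, v)"]) auto
  qed
qed auto

section \<open>Positions and their gap multisets\<close>

definition has_gaps :: "nat \<Rightarrow> (nat, nat) position \<Rightarrow> gap_class multiset \<Rightarrow> bool" where
  "has_gaps n m M \<longleftrightarrow>
     (\<exists>c s L. c < n \<and> reads n m c (word s L) \<and> gaps_ok s L \<and> gaps s L = M)"

lemma word_None_index:
  assumes "length (word s L) = Suc n" "word s L ! j = None" "j \<le> n"
  shows "0 < j" "j < n"
proof -
  show "0 < j" using assms by (cases j) auto
  have "word s L ! n \<noteq> None"
    using last_word[of s L] assms(1) by (simp add: last_conv_nth)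
  then show "j < n" using assms by (cases "j = n") auto
qed

lemma has_gaps_sink_free:
  "n > 1 \<Longrightarrow> has_gaps n m M \<Longrightarrow> \<not> sink (cycle_board n) m v"
  unfolding has_gaps_def using sink_free_reads sink_free_word by blast

text \<open>With \<open>has_gaps_step\<close>, this makes \<open>has_gaps\<close> a bisimulation
  between the game and \<open>step\<close>, which transfers replies from multisets to the
  cycle.\<close>

lemma has_gaps_move:
  assumes n: "n > 1" and m: "has_gaps n m M" and q: "q \<in> game_moves (cycle_board n) m"
  obtains M' where "has_gaps n q M'" "step M M'"
proof -
  from m obtain c s L where c: "c < n" "reads n m c (word s L)" "gaps_ok s L" "gaps s L = M"
    unfolding has_gaps_def by blast
  obtain e u where e: "e < n" "m e = None" "q = m(e \<mapsto> arrow n e u)"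
    and sf: "\<And>v. \<not> sink (cycle_board n) q v"
    using game_movesE[OF q has_gaps_sink_free[OF n m]] by blast
  obtain j where j: "j < n" "e = (c + j) mod n" using cycle_offset[OF e(1) c(1)] .
  have len: "length (word s L) = Suc n" using c(2) by (simp add: reads_def)
  have None: "word s L ! j = None" using c(2) e(2) j by (auto simp: reads_def)
  have "0 < j" using word_None_index[OF len None] j by simp
  then have rq: "reads n q c ((word s L)[j := Some u])"
    unfolding e(3) using reads_update c j by blast
  then have "sink_free ((word s L)[j := Some u])"
    using sink_free_reads n c(1) sf by blast
  then obtain L' where "(word s L)[j := Some u] = word s L'" "gaps_ok s L'"
    "step (gaps s L) (gaps s L')"
    using word_update_step[of j s L u] len None j by auto
  then show thesis using that rq c unfolding has_gaps_def by metis
qed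

lemma has_gaps_step:
  assumes n: "n > 1" and m: "has_gaps n m M" and st: "step M M'"
  obtains q where "q \<in> game_moves (cycle_board n) m" "has_gaps n q M'"
proof -
  from m obtain c s L where c: "c < n" "reads n m c (word s L)" "gaps_ok s L" "gaps s L = M"
    unfolding has_gaps_def by blast
  have len: "length (word s L) = Suc n" using c(2) by (simp add: reads_def)
  obtain j u L' where j: "j \<le> n" "word s L ! j = None"
    "(word s L)[j := Some u] = word s L'" "gaps_ok s L'" "gaps s L' = M'"
    using step_word_update[of s L M'] st c len by (metis less_Suc_eq_le)
  note pos = word_None_index[OF len j(2,1)]
  define e where "e = (c + j) mod n"
  let ?q = "m(e \<mapsto> arrow n e u)"
  have "reads n ?q c (word s L')"
    using reads_update[OF c(2) pos e_def] j by metis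
  then have q: "has_gaps n ?q M'" unfolding has_gaps_def using c j by blast
  have "m e = None" using c(2) j unfolding reads_def e_def by simp
  moreover have "e < n" using n by (simp add: e_def)
  ultimately have "?q \<in> game_moves (cycle_board n) m"
    using game_movesI has_gaps_sink_free[OF n q] by blast
  then show thesis using q that by blast
qed

text \<open>The only marked edge bounds the single gap on both sides, hence with equal signs; this
  gives class \<open>A\<close>.\<close>

lemma has_gaps_first_move:
  assumes n: "n > 1" and q: "q \<in> game_moves (cycle_board n) Map.empty"
  shows "has_gaps n q {#A (n - 1)#}"
proof -
  have "\<not> sink (cycle_board n) Map.empty v" for v
  proof
    assume "sink (cycle_board n) Map.empty v"
    then show False by (auto simp: sink_def cycle_board_def)
  qed
  then obtain e s where e: "e < n" "q = Map.empty(e \<mapsto> arrow n e s)"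
    using game_movesE[OF q] by metis
  have "map_option (arrow n ((e + i) mod n)) (word s [(n - 1, s)] ! i) = q ((e + i) mod n)"
    if "i \<le> n" for i
  proof -
    consider "i = 0" | "i = n" | "0 < i" "i < n" using \<open>i \<le> n\<close> by fastforce
    then show ?thesis
    proof cases
      case 3
      then have "(e + i) mod n \<noteq> e" using cycle_offset_inj[of e 0 n i] e by auto
      then show ?thesis using 3 e by (auto simp: nth_append nth_Cons split: nat.splits)
    qed (use e n in \<open>auto simp: nth_append nth_Cons split: nat.splits\<close>)
  qed
  then have "reads n q e (word s [(n - 1, s)])" using n by (auto simp: reads_def)
  then show ?thesis
    unfolding has_gaps_def using e(1)
    by (intro exI[of _ e] exI[of _ s] exI[of _ "[(n - 1, s)]"]) (auto simp: gap_def gap_ok_def)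
qed

section \<open>The second player's strategy\<close>

theorem theorem5:
  fixes n :: nat
  assumes "n > 1"
  shows "nimber (game_moves (cycle_board n)) Map.empty = 0"
proof (rule nimber_eq_0I)
  \<comment> \<open>A word begins with a sign, so the unmarked board has no gap multiset and is
    added separately.\<close>
  let ?Z = "insert Map.empty {m. \<exists>K. has_gaps n m (K + K)}"
  show "wf {(q, p). q \<in> game_moves (cycle_board n) p}"
    by (rule wf_game_moves) (simp add: cycle_board_def)
  show "finite (game_moves (cycle_board n) p)" for p
    by (rule finite_game_moves_cycle)
  show "Map.empty \<in> ?Z" by simp
  fix p q assume p: "p \<in> ?Z" and q: "q \<in> game_moves (cycle_board n) p"
  \<comment> \<open>\<open>M\<close> describes the position after the first player's move,
    \<open>K + K\<close> the one to aim for in reply.\<close>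
  obtain M K where "has_gaps n q M" "step M (K + K)"
  proof (cases "p = Map.empty")
    case True
    then have "has_gaps n q {#A (n - 1)#}" using has_gaps_first_move assms q by blast
    moreover obtain K where "step {#A (n - 1)#} (K + K)"
      using step_A_double[of "n - 1"] assms by (metis zero_less_diff)
    ultimately show thesis by (rule that)
  next
    case False
    with p obtain N where "has_gaps n p (N + N)" by blast
    with q assms obtain M where "has_gaps n q M" "step (N + N) M"
      using has_gaps_move by blast
    then show thesis using that step_double by blast
  qed
  then show "\<exists>r \<in> game_moves (cycle_board n) q. r \<in> ?Z"
    using has_gaps_step[OF assms] by blast
qed

end
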